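(* Let $\mathbb D=\{z\in\mathbb C: |z|<1\}$. A vector $(\alpha,\beta)\in\mathbb C^2$ is the Wirtinger derivative at $0$ of some harmonic map $f\colon\mathbb D\to\mathbb D$, i.e. $(\partial f(0),\bar\partial f(0))=(\alpha,\beta)$ for some harmonic $f\colon \mathbb D\to\mathbb D$, if and only if $\|(\alpha,\beta)\|_{H^1_*}\le 1$.
   Context: A harmonic map $f\colon\mathbb D\to\mathbb D$ is a complex-valued function with values in $\mathbb D$ satisfying the Laplace equation $\partial\bar\partial f=0$ on $\mathbb D$, where the Wirtinger derivatives are $\partial f=\frac12\left(\frac{\partial f}{\partial x}-i\frac{\partial f}{\partial y}\right)$ and $\bar\partial f=\frac12\left(\frac{\partial f}{\partial x}+i\frac{\partial f}{\partial y}\right)$. For $(a_1,a_2)\in\mathbb C^2$ the Hardy norm is $\|(a_1,a_2)\|_{H^1}=\frac1{2\pi}\int_0^{2\pi}|a_1+a_2e^{it}|\,dt$. Its dual norm on $\mathbb C^2$ is $\|\xi\|_{H^1_*}=\sup\{|\langle\xi,\eta\rangle| : \eta\in\mathbb C^2,\ \|\eta\|_{H^1}\le 1\}$, where $\langle\xi,\eta\rangle=\xi_1\overline{\eta_1}+\xi_2\overline{\eta_2}$. *)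

theory Defs
  imports "HOL-Analysis.Analysis"
begin

definition partial_x :: "(complex \<Rightarrow> complex) \<Rightarrow> complex \<Rightarrow> complex" where
  "partial_x f z = vector_derivative (\<lambda>x. f (Complex x (Im z))) (at (Re z))"

definition partial_y :: "(complex \<Rightarrow> complex) \<Rightarrow> complex \<Rightarrow> complex" where
  "partial_y f z = vector_derivative (\<lambda>y. f (Complex (Re z) y)) (at (Im z))"

definition wirtinger :: "(complex \<Rightarrow> complex) \<Rightarrow> complex \<Rightarrow> complex" where
  "wirtinger f z = (partial_x f z - \<i> * partial_y f z) / 2"

definition wirtinger_bar :: "(complex \<Rightarrow> complex) \<Rightarrow> complex \<Rightarrow> complex" where
  "wirtinger_bar f z = (partial_x f z + \<i> * partial_y f z) / 2"

text \<open>Continuous differentiability in the real sense on an open set. Here \<open>differentiable\<close> is real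
  (Frechet) differentiability; on an open set this definition agrees with mere existence and
  continuity of the two partial derivatives.\<close>

definition C1_real_on :: "(complex \<Rightarrow> complex) \<Rightarrow> complex set \<Rightarrow> bool" where
  "C1_real_on f S \<longleftrightarrow>
     (\<forall>z\<in>S. f differentiable (at z)) \<and>
     continuous_on S (partial_x f) \<and> continuous_on S (partial_y f)"

definition C2_real_on :: "(complex \<Rightarrow> complex) \<Rightarrow> complex set \<Rightarrow> bool" where
  "C2_real_on f S \<longleftrightarrow>
     C1_real_on f S \<and> C1_real_on (partial_x f) S \<and> C1_real_on (partial_y f) S"

text \<open>The usual convention that a harmonic function is twice continuously differentiable is made
  explicit, so that the Laplace equation never refers to the default value that
  \<open>vector_derivative\<close> takes where no derivative exists.\<close>

definition harmonic_on :: "(complex \<Rightarrow> complex) \<Rightarrow> complex set \<Rightarrow> bool" where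
  "harmonic_on f S \<longleftrightarrow>
     open S \<and> C2_real_on f S \<and> (\<forall>z\<in>S. wirtinger (wirtinger_bar f) z = 0)"

definition hardy_norm :: "complex \<times> complex \<Rightarrow> real" where
  "hardy_norm a =
     1 / (2 * pi) * integral {0..2 * pi} (\<lambda>t. norm (fst a + snd a * exp (\<i> * of_real t)))"

definition herm_pairing :: "complex \<times> complex \<Rightarrow> complex \<times> complex \<Rightarrow> complex" where
  "herm_pairing \<xi> \<eta> = fst \<xi> * cnj (fst \<eta>) + snd \<xi> * cnj (snd \<eta>)"

text \<open>The real-valued supremum is a genuine one: the set contains \<open>0\<close>, and it is bounded because
  each component of \<open>\<eta>\<close> has modulus at most \<open>hardy_norm \<eta>\<close>.\<close>

definition hardy_dual_norm :: "complex \<times> complex \<Rightarrow> real" where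
  "hardy_dual_norm \<xi> = (SUP \<eta>\<in>{\<eta>. hardy_norm \<eta> \<le> 1}. norm (herm_pairing \<xi> \<eta>))"

end

theory Submission
  imports Defs "HOL-Complex_Analysis.Complex_Analysis" "HOL-Probability.Probability"
begin

text \<open>A harmonic function on the disc splits as \<open>f = g + cnj h\<close> with \<open>g\<close> and \<open>h\<close> holomorphic, so the average
  of \<open>f\<close> against the conjugate of \<open>\<eta>\<^sub>1 cis s + \<eta>\<^sub>2 cis (- s)\<close> over the circle of radius \<open>r\<close> is \<open>r\<close> times
  the pairing of the Wirtinger derivative with \<open>\<eta>\<close>; if \<open>\<bar>f\<bar> < 1\<close>, its modulus is at most the Hardy norm
  of \<open>\<eta>\<close>.

  Conversely, let \<open>N\<close> be the dual norm of \<open>\<xi>\<close> and \<open>\<eta>\<close> a maximizer of \<open>Re \<langle>\<xi>, \<eta>\<rangle>\<close> on the Hardy unit ball.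
  Since \<open>N\<close> times the Hardy norm minus \<open>Re \<langle>\<xi>, \<cdot>\<rangle>\<close> is minimal at \<open>\<eta>\<close>, differentiating under the integral
  shows that \<open>\<xi>\<close> is \<open>N\<close> times the pair of Fourier coefficients of
  \<open>\<sigma> t = sgn (\<eta>\<^sub>1 + \<eta>\<^sub>2 cis t)\<close>. With \<open>cis (- t / 2) * \<sigma> t\<close> prescribed at the point \<open>cis (- t / 2)\<close> of a half
  circle and extended oddly to the full circle, \<open>N\<close> times the Poisson integral is a harmonic map
  with Wirtinger derivative \<open>\<xi>\<close>. Only the odd part of the Poisson kernel enters, and its absolute
  value is less than the even part by a positive constant; this keeps the values in the open disc.\<close>

section \<open>Wirtinger derivatives and the splitting of harmonic functions\<close>

lemma partials_of_has_derivative: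
  assumes "(f has_derivative D) (at z)"
  shows "partial_x f z = D 1" and "partial_y f z = D \<i>"
proof -
  have lin: "linear D"
    using assms by (rule has_derivative_linear)
  have "((\<lambda>x. Complex x (Im z)) has_derivative (\<lambda>t. t *\<^sub>R 1)) (at (Re z))"
    unfolding Complex_eq by (auto intro!: derivative_eq_intros simp: scaleR_conv_of_real)
  from has_derivative_compose[OF this, of f D] assms
  have "((\<lambda>x. f (Complex x (Im z))) has_vector_derivative D 1) (at (Re z))"
    by (simp add: has_vector_derivative_def linear_cmul[OF lin])
  then show "partial_x f z = D 1"
    unfolding partial_x_def by (rule vector_derivative_at)
  have "((\<lambda>y. Complex (Re z) y) has_derivative (\<lambda>t. t *\<^sub>R \<i>)) (at (Im z))"
    unfolding Complex_eq by (auto intro!: derivative_eq_intros simp: scaleR_conv_of_real)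
  from has_derivative_compose[OF this, of f D] assms
  have "((\<lambda>y. f (Complex (Re z) y)) has_vector_derivative D \<i>) (at (Im z))"
    by (simp add: has_vector_derivative_def linear_cmul[OF lin])
  then show "partial_y f z = D \<i>"
    unfolding partial_y_def by (rule vector_derivative_at)
qed

text \<open>Vanishing of \<open>wirtinger_bar f z\<close> gives \<open>D \<i> = \<i> * D 1\<close>
  (Cauchy-Riemann), which makes the real-linear derivative \<open>D\<close> multiplication by
  \<open>D 1\<close>.\<close>

lemma has_field_derivative_wirtinger:
  assumes diff: "f differentiable (at z)" and bar: "wirtinger_bar f z = 0"
  shows "(f has_field_derivative wirtinger f z) (at z)"
proof -
  obtain D where D: "(f has_derivative D) (at z)"
    using diff unfolding differentiable_def by blast
  have lin: "linear D"
    using D by (rule has_derivative_linear)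
  have "D 1 + \<i> * D \<i> = 0"
    using bar unfolding wirtinger_bar_def by (simp add: partials_of_has_derivative[OF D])
  then have Di: "D \<i> = \<i> * D 1"
    by (metis add_eq_0_iff complex_i_mult_minus mult_minus_right add.inverse_inverse)
  have w: "wirtinger f z = D 1"
    unfolding wirtinger_def by (simp add: partials_of_has_derivative[OF D] Di mult.assoc[symmetric])
  have "D v = D 1 * v" for v
  proof -
    have "v = Re v *\<^sub>R 1 + Im v *\<^sub>R \<i>"
      by (simp add: complex_eq_iff)
    then have "D v = D (Re v *\<^sub>R 1 + Im v *\<^sub>R \<i>)"
      by metis
    also have "\<dots> = Re v *\<^sub>R D 1 + Im v *\<^sub>R D \<i>"
      by (simp add: linear_add[OF lin] linear_cmul[OF lin])
    also have "\<dots> = D 1 * (of_real (Re v) + \<i> * of_real (Im v))"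
      by (simp add: Di scaleR_conv_of_real algebra_simps)
    finally show ?thesis using complex_eq[of v] by simp
  qed
  then have "D = (*) (D 1)" by blast
  then show ?thesis using D w unfolding has_field_derivative_def by metis
qed

text \<open>Agreement of \<open>f\<close> with the sum is asked on \<open>S\<close> alone, because
  this lemma and those built on it are also applied to partial derivatives, whose form is known only
  on \<open>S\<close>.\<close>

lemma has_derivative_holomorphic_add_cnj:
  assumes "open S" "g holomorphic_on S" "h holomorphic_on S" "z \<in> S"
    and f: "\<And>w. w \<in> S \<Longrightarrow> f w = g w + cnj (h w)"
  shows "(f has_derivative (\<lambda>v. deriv g z * v + cnj (deriv h z * v))) (at z)"
proof -
  have *: "(g has_derivative (*) (deriv g z)) (at z)" "(h has_derivative (*) (deriv h z)) (at z)"
    using holomorphic_derivI[OF assms(2,1,4)] holomorphic_derivI[OF assms(3,1,4)]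
    unfolding has_field_derivative_def by auto
  have "((\<lambda>w. g w + cnj (h w)) has_derivative (\<lambda>v. deriv g z * v + cnj (deriv h z * v))) (at z)"
    by (intro has_derivative_add has_derivative_cnj *)
  then show ?thesis
    by (rule has_derivative_transform_within_open[OF _ assms(1,4)]) (simp add: f)
qed

lemma partials_holomorphic_add_cnj:
  assumes "open S" "g holomorphic_on S" "h holomorphic_on S" "z \<in> S"
    and f: "\<And>w. w \<in> S \<Longrightarrow> f w = g w + cnj (h w)"
  shows "partial_x f z = deriv g z + cnj (deriv h z)"
    and "partial_y f z = \<i> * deriv g z + cnj (\<i> * deriv h z)"
    and "wirtinger f z = deriv g z"
    and "wirtinger_bar f z = cnj (deriv h z)"
proof -
  note D = has_derivative_holomorphic_add_cnj[OF assms]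
  show x: "partial_x f z = deriv g z + cnj (deriv h z)"
    and y: "partial_y f z = \<i> * deriv g z + cnj (\<i> * deriv h z)"
    by (simp_all add: partials_of_has_derivative[OF D])
  show "wirtinger f z = deriv g z" "wirtinger_bar f z = cnj (deriv h z)"
    unfolding wirtinger_def wirtinger_bar_def x y
    by (simp_all add: algebra_simps mult.assoc[symmetric])
qed

lemma C1_real_on_holomorphic_add_cnj:
  assumes S: "open S" and g: "g holomorphic_on S" and h: "h holomorphic_on S"
    and f: "\<And>w. w \<in> S \<Longrightarrow> f w = g w + cnj (h w)"
  shows "C1_real_on f S"
proof -
  note [holomorphic_intros] = holomorphic_deriv[OF g S] holomorphic_deriv[OF h S]
  have "continuous_on S (\<lambda>z. deriv g z + cnj (deriv h z))"
    by (intro continuous_intros holomorphic_on_imp_continuous_on holomorphic_intros)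
  moreover have "continuous_on S (\<lambda>z. \<i> * deriv g z + cnj (\<i> * deriv h z))"
    by (intro continuous_intros holomorphic_on_imp_continuous_on holomorphic_intros)
  ultimately show ?thesis
    unfolding C1_real_on_def differentiable_def
    using has_derivative_holomorphic_add_cnj[OF S g h _ f]
      partials_holomorphic_add_cnj(1,2)[OF S g h _ f]
    by (metis (no_types, lifting) continuous_on_cong)
qed

text \<open>Both partial derivatives of such a sum are again a holomorphic function plus the
  conjugate of one, so the C1 lemma applies to each of them.\<close>

lemma harmonic_on_holomorphic_add_cnj:
  assumes S: "open S" and g: "g holomorphic_on S" and h: "h holomorphic_on S"
  shows "harmonic_on (\<lambda>z. g z + cnj (h z)) S"
proof -
  let ?f = "\<lambda>z. g z + cnj (h z)"
  note dg = holomorphic_deriv[OF g S] and dh = holomorphic_deriv[OF h S]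
  note p = partials_holomorphic_add_cnj[OF S g h _ refl]
  have "C1_real_on ?f S"
    by (rule C1_real_on_holomorphic_add_cnj[OF S g h refl])
  moreover have "C1_real_on (partial_x ?f) S"
    by (rule C1_real_on_holomorphic_add_cnj[OF S dg dh p(1)])
  moreover have "C1_real_on (partial_y ?f) S"
    by (rule C1_real_on_holomorphic_add_cnj[OF S _ _ p(2)]) (intro holomorphic_intros dg dh)+
  \<comment> \<open>On \<open>S\<close>, \<open>wirtinger_bar ?f\<close> is
    \<open>cnj (deriv h)\<close>, a sum whose holomorphic part is 0.\<close>
  moreover have "wirtinger (wirtinger_bar ?f) z = 0" if "z \<in> S" for z
    using partials_holomorphic_add_cnj(3)[OF S holomorphic_on_const[of 0] dh that,
        of "wirtinger_bar ?f"] p(4) by simp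
  ultimately show ?thesis
    unfolding harmonic_on_def C2_real_on_def using S by blast
qed

text \<open>The Laplace equation makes \<open>?k\<close>, the conjugate of
  \<open>wirtinger_bar f\<close>, holomorphic. Convexity provides a primitive \<open>h\<close> of
  \<open>?k\<close>, and subtracting \<open>cnj h\<close> from \<open>f\<close> cancels
  \<open>wirtinger_bar f\<close>, so the rest \<open>g\<close> is holomorphic as well.\<close>

lemma harmonic_on_decompose:
  assumes harm: "harmonic_on f S" and "convex S"
  obtains g h where "g holomorphic_on S" "h holomorphic_on S"
    "\<And>z. z \<in> S \<Longrightarrow> f z = g z + cnj (h z)"
proof -
  have S: "open S"
    using harm unfolding harmonic_on_def by blast
  let ?k = "\<lambda>z. cnj (wirtinger_bar f z)"
  have "?k field_differentiable (at z)" if z: "z \<in> S" for z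
  proof -
    have "partial_x f differentiable (at z)" "partial_y f differentiable (at z)"
      using harm z unfolding harmonic_on_def C2_real_on_def C1_real_on_def by auto
    then have "(\<lambda>z. partial_x f z + \<i> * partial_y f z) differentiable (at z)"
      by (intro differentiable_add differentiable_mult differentiable_const)
    then have "wirtinger_bar f differentiable (at z)"
      unfolding wirtinger_bar_def divide_inverse by (intro differentiable_mult differentiable_const)
    then obtain D where D: "(wirtinger_bar f has_derivative D) (at z)"
      unfolding differentiable_def by blast
    have "wirtinger (wirtinger_bar f) z = 0"
      using harm z unfolding harmonic_on_def by blast
    then have w: "D 1 - \<i> * D \<i> = 0"
      unfolding wirtinger_def partials_of_has_derivative[OF D] by simp
    have D': "(?k has_derivative (\<lambda>v. cnj (D v))) (at z)"
      by (rule has_derivative_cnj[OF D])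
    \<comment> \<open>Conjugation interchanges the two Wirtinger operators, so
      \<open>wirtinger_bar ?k z\<close> is the conjugate of
      \<open>wirtinger (wirtinger_bar f) z\<close>.\<close>
    have "wirtinger_bar ?k z = cnj (D 1 - \<i> * D \<i>) / 2"
      unfolding wirtinger_bar_def[of ?k] partials_of_has_derivative[OF D'] by simp
    then have "wirtinger_bar ?k z = 0"
      using w by simp
    moreover have "?k differentiable (at z)"
      using D' unfolding differentiable_def by blast
    ultimately show ?thesis
      using has_field_derivative_wirtinger field_differentiable_def by blast
  qed
  then have "?k holomorphic_on S"
    by (auto simp: holomorphic_on_def intro: field_differentiable_at_within)
  then obtain h where h: "\<And>z. z \<in> S \<Longrightarrow> (h has_field_derivative ?k z) (at z within S)"
    using holomorphic_convex_primitive'[OF \<open>convex S\<close> S] by blast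
  then have h_holo: "h holomorphic_on S"
    using holomorphic_on_def field_differentiable_def by blast
  define g where "g = (\<lambda>z. f z - cnj (h z))"
  have "g field_differentiable (at z)" if z: "z \<in> S" for z
  proof -
    have "f differentiable (at z)"
      using harm z unfolding harmonic_on_def C2_real_on_def C1_real_on_def by auto
    then obtain D where D: "(f has_derivative D) (at z)"
      unfolding differentiable_def by blast
    have "(h has_field_derivative ?k z) (at z)"
      using h[OF z] at_within_open[OF z S] by simp
    then have "(h has_derivative (*) (?k z)) (at z)"
      unfolding has_field_derivative_def by simp
    then have D': "(g has_derivative (\<lambda>v. D v - cnj (?k z * v))) (at z)"
      unfolding g_def by (intro has_derivative_diff has_derivative_cnj D)
    have "wirtinger_bar g z = wirtinger_bar f z - cnj (?k z)"
      unfolding wirtinger_bar_def[of g] partials_of_has_derivative[OF D']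
      unfolding wirtinger_bar_def[of f] partials_of_has_derivative[OF D]
      by (simp add: field_simps)
    then have "wirtinger_bar g z = 0"
      by simp
    moreover have "g differentiable (at z)"
      using D' unfolding differentiable_def by blast
    ultimately show ?thesis
      using has_field_derivative_wirtinger field_differentiable_def by blast
  qed
  then have "g holomorphic_on S"
    by (auto simp: holomorphic_on_def intro: field_differentiable_at_within)
  with h_holo show thesis
    using that by (simp add: g_def)
qed

section \<open>Averages over the circle as expectations under a probability measure\<close>

definition circ_measure :: "real measure" where
  "circ_measure = uniform_measure lborel {0..2 * pi}"

lemma sets_circ_measure [simp, measurable_cong]: "sets circ_measure = sets borel"
  by (simp add: circ_measure_def)

lemma space_circ_measure [simp]: "space circ_measure = UNIV"
  by (simp add: circ_measure_def)

interpretation circ: prob_space circ_measure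
  unfolding circ_measure_def by (rule prob_space_uniform_measure) simp_all

lemma integrable_circ_bounded:
  fixes f :: "real \<Rightarrow> 'b::{banach, second_countable_topology}"
  assumes "f \<in> borel_measurable borel" and "\<And>t. norm (f t) \<le> B"
  shows "integrable circ_measure f"
  by (rule circ.integrable_const_bound[where B = B]) (use assms in simp_all)

lemma integrable_circ_continuous:
  fixes f :: "real \<Rightarrow> 'b::{banach, second_countable_topology}"
  assumes f: "continuous_on UNIV f"
  shows "integrable circ_measure f"
proof -
  have "compact (f ` {0..2 * pi})"
    by (intro compact_continuous_image continuous_on_subset[OF f]) auto
  then obtain B where B: "\<And>t. t \<in> {0..2 * pi} \<Longrightarrow> norm (f t) \<le> B"
    using compact_imp_bounded bounded_iff by (metis imageI)
  \<comment> \<open>The bound from compactness holds on the interval carrying the measure, hence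
    almost everywhere; elsewhere \<open>f\<close> may be unbounded.\<close>
  have "AE t in circ_measure. norm (f t) \<le> B"
    unfolding circ_measure_def by (intro AE_uniform_measureI AE_I2) (auto intro: B)
  moreover have "f \<in> borel_measurable circ_measure"
    using borel_measurable_continuous_onI[OF f] by simp
  ultimately show ?thesis
    by (rule circ.integrable_const_bound)
qed

lemma integral_circ_continuous:
  fixes f :: "real \<Rightarrow> 'b::euclidean_space"
  assumes f: "continuous_on UNIV f"
  shows "integral\<^sup>L circ_measure f = (1 / (2 * pi)) *\<^sub>R integral {0..2 * pi} f"
proof -
  have "indicator {0..2 * pi} x / emeasure lborel {0..2 * pi} =
      ennreal (indicator {0..2 * pi} x / (2 * pi))" for x :: real
    by (auto split: split_indicator simp: divide_ennreal simp flip: ennreal_1)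
  then have eq: "circ_measure = density lborel (\<lambda>x. ennreal (indicator {0..2 * pi} x / (2 * pi)))"
    unfolding circ_measure_def uniform_measure_def by simp
  have "integral\<^sup>L circ_measure f = (\<integral>x. (indicator {0..2 * pi} x / (2 * pi)) *\<^sub>R f x \<partial>lborel)"
    unfolding eq using borel_measurable_continuous_onI[OF f]
    by (intro integral_density) simp_all
  also have "\<dots> = (\<integral>x. (1 / (2 * pi)) *\<^sub>R (indicator {0..2 * pi} x *\<^sub>R f x) \<partial>lborel)"
    by simp
  also have "\<dots> = (1 / (2 * pi)) *\<^sub>R (LINT x : {0..2 * pi} | lborel. f x)"
    unfolding set_lebesgue_integral_def by (rule integral_scaleR_right)
  also have "(LINT x : {0..2 * pi} | lborel. f x) = integral {0..2 * pi} f"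
    by (intro set_borel_integral_eq_integral borel_integrable_atLeastAtMost'
        continuous_on_subset[OF f]) auto
  finally show ?thesis .
qed

lemma continuous_on_circle_param:
  assumes "continuous_on (cball 0 r) f" and "0 \<le> r"
  shows "continuous_on UNIV (\<lambda>t. f (of_real r * cis t))"
  by (rule continuous_on_compose2[OF assms(1)])
    (use \<open>0 \<le> r\<close> in \<open>auto intro!: continuous_intros simp: norm_mult\<close>)

text \<open>Cauchy's formula for the \<open>k\<close>-th derivative at the centre, read as a Fourier
  coefficient of \<open>f\<close> on the circle.\<close>

lemma circ_integral_Cauchy:
  assumes r: "0 < r" and cont: "continuous_on (cball 0 r) f" and holo: "f holomorphic_on ball 0 r"
  shows "(\<integral>t. f (of_real r * cis t) * cis (- (real k * t)) \<partial>circ_measure) =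
    of_real r ^ k * (deriv ^^ k) f 0 / fact k"
proof -
  let ?F = "\<lambda>t. f (of_real r * cis t) * cis (- (real k * t))"
  define I where "I = 2 * pi * \<i> / fact k * (deriv ^^ k) f 0"
  have "((\<lambda>u. f u / (u - 0) ^ Suc k) has_contour_integral I) (circlepath 0 r)"
    unfolding I_def
    by (rule Cauchy_has_contour_integral_higher_derivative_circlepath[OF cont holo]) (use r in simp)
  then have "((\<lambda>t. f (of_real r * cis t) / (of_real r * cis t) ^ Suc k * r * \<i> * cis t)
      has_integral I) {0..2 * pi}"
    unfolding circlepath_def by (subst (asm) has_contour_integral_part_circlepath_iff) simp_all
  then have "((\<lambda>t. of_real r ^ k / \<i> * (f (of_real r * cis t) / (of_real r * cis t) ^ Suc k * r * \<i> * cis t))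
      has_integral of_real r ^ k / \<i> * I) {0..2 * pi}"
    by (rule has_integral_mult_right)
  moreover have "of_real r ^ k / \<i> * (f (of_real r * cis t) / (of_real r * cis t) ^ Suc k * r * \<i> * cis t) = ?F t"
    for t
  proof -
    have "cis (- (real k * t)) = inverse (cis t ^ k)"
      by (simp only: Complex.DeMoivre cis_inverse)
    then show ?thesis
      using r by (simp add: power_mult_distrib field_simps)
  qed
  ultimately have "integral {0..2 * pi} ?F = of_real r ^ k / \<i> * I"
    by (simp add: integral_unique)
  moreover have "continuous_on UNIV ?F"
    using r by (intro continuous_on_mult continuous_on_circle_param[OF cont] continuous_intros) simp_all
  ultimately have "integral\<^sup>L circ_measure ?F = (1 / (2 * pi)) *\<^sub>R (of_real r ^ k / \<i> * I)"
    by (simp add: integral_circ_continuous)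
  then show ?thesis
    unfolding I_def by (simp add: scaleR_conv_of_real mult.left_commute[of "of_real r ^ k" \<i>])
qed

lemma circ_integral_mean_value:
  assumes "0 < r" "continuous_on (cball 0 r) f" "f holomorphic_on ball 0 r"
  shows "(\<integral>t. f (of_real r * cis t) \<partial>circ_measure) = f 0"
  using circ_integral_Cauchy[OF assms, of 0] by simp

text \<open>Mean value property of \<open>z * f z / of_real r\<close>, which vanishes at 0: a
  holomorphic function has no Fourier coefficient of order -1.\<close>

lemma circ_integral_mult_cis:
  assumes r: "0 < r" and "continuous_on (cball 0 r) f" "f holomorphic_on ball 0 r"
  shows "(\<integral>t. f (of_real r * cis t) * cis t \<partial>circ_measure) = 0"
proof -
  have "(\<integral>t. of_real r * cis t * f (of_real r * cis t) / of_real r \<partial>circ_measure) = 0"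
    by (subst circ_integral_mean_value[OF r, of "\<lambda>z. z * f z / of_real r"])
      (use assms in \<open>auto intro!: continuous_intros holomorphic_intros\<close>)
  then show ?thesis
    using r by (simp add: mult.commute)
qed

text \<open>As \<open>s\<close> runs through either of \<open>{0..pi}\<close> and
  \<open>{pi..2 * pi}\<close>, \<open>cis (- (2 * s))\<close> goes once round the circle. The
  substitutions \<open>2 * pi - 2 * s\<close> and \<open>4 * pi - 2 * s\<close> return the angle to
  \<open>{0..2 * pi}\<close>.\<close>

lemma circ_integral_cis_double:
  fixes F :: "complex \<Rightarrow> 'b::euclidean_space"
  assumes F: "continuous_on (sphere 0 1) F"
  shows "(\<integral>s. F (cis (- (2 * s))) \<partial>circ_measure) = (\<integral>t. F (cis t) \<partial>circ_measure)"
proof -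
  have cont: "continuous_on UNIV (\<lambda>t. F (cis (c * t)))" for c
    by (rule continuous_on_compose2[OF F]) (auto intro!: continuous_intros)
  define I where "I = integral {0..2 * pi} (\<lambda>t. F (cis t))"
  have I: "((\<lambda>t. F (cis t)) has_integral I) (cbox 0 (2 * pi))"
    unfolding I_def using cont[of 1]
    by (auto intro!: integrable_integral integrable_continuous_real continuous_on_subset[OF cont[of 1, simplified]])
  have per: "cis (2 * pi - 2 * x) = cis (- (2 * x))" "cis (4 * pi - 2 * x) = cis (- (2 * x))" for x
    using cis_mult[of "2 * pi" "- (2 * x)"] cis_mult[of "4 * pi" "- (2 * x)"]
      cis_multiple_2pi[of 2] by (simp_all only: cis_2pi) (simp_all add: mult.commute)
  have img: "(\<lambda>x. c - x / 2) ` {0..2 * pi} = {c - pi..c}" for c :: real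
    by (auto intro!: image_eqI[of _ _ "2 * (c - x)" for x] simp: field_simps)
  have "((\<lambda>s. F (cis (- (2 * s)))) has_integral (1 / 2) *\<^sub>R I) {0..pi}"
    using has_integral_affinity[OF I, of "-2" "2 * pi"]
    by (simp add: per img)
  moreover have "((\<lambda>s. F (cis (- (2 * s)))) has_integral (1 / 2) *\<^sub>R I) {pi..2 * pi}"
    using has_integral_affinity[OF I, of "-2" "4 * pi"]
    by (simp add: per img)
  ultimately have "((\<lambda>s. F (cis (- (2 * s)))) has_integral (1 / 2) *\<^sub>R I + (1 / 2) *\<^sub>R I) {0..2 * pi}"
    by (rule has_integral_combine[rotated 2]) simp_all
  then have "integral {0..2 * pi} (\<lambda>s. F (cis (- (2 * s)))) = I"
    by (simp add: integral_unique scaleR_left.add[symmetric])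
  then show ?thesis
    using cont[of "-2"] cont[of 1] by (simp add: integral_circ_continuous I_def)
qed

section \<open>Necessity: the pairing bound for harmonic self-maps of the disc\<close>

lemma hardy_norm_eq: "hardy_norm a = (\<integral>t. norm (fst a + snd a * cis t) \<partial>circ_measure)"
  unfolding hardy_norm_def cis_conv_exp[symmetric]
  by (subst integral_circ_continuous) (auto intro!: continuous_intros)

text \<open>The average is taken over a circle of radius \<open>r < 1\<close>, as \<open>f\<close>
  is controlled only inside the disc; the factor \<open>r\<close> comes from the first-order Taylor
  terms of \<open>g\<close> and \<open>h\<close>.\<close>

lemma harmonic_on_norm_herm_pairing_le:
  assumes harm: "harmonic_on f (ball 0 1)" and disc: "f ` ball 0 1 \<subseteq> ball 0 1"
    and r: "0 < r" "r < 1"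
  shows "r * norm (herm_pairing (wirtinger f 0, wirtinger_bar f 0) \<eta>) \<le> hardy_norm \<eta>"
proof -
  obtain g h where g: "g holomorphic_on ball 0 1" and h: "h holomorphic_on ball 0 1"
    and f: "\<And>z. z \<in> ball 0 1 \<Longrightarrow> f z = g z + cnj (h z)"
    using harmonic_on_decompose[OF harm convex_ball] by blast
  have w: "wirtinger f 0 = deriv g 0" "wirtinger_bar f 0 = cnj (deriv h 0)"
    using partials_holomorphic_add_cnj(3,4)[OF open_ball g h _ f, of 0] by simp_all
  have sub: "cball 0 r \<subseteq> ball (0::complex) 1"
    using r by auto
  note cont = continuous_on_subset[OF holomorphic_on_imp_continuous_on sub]
  note holo = holomorphic_on_subset[OF _ order_trans[OF ball_subset_cball sub]]
  let ?z = "\<lambda>s. of_real r * cis s"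
  \<comment> \<open>Against this factor, \<open>fst \<eta>\<close> meets the Fourier coefficient of
    \<open>f\<close> of order 1, which comes from \<open>g\<close>, and \<open>snd \<eta>\<close>
    that of order -1, which comes from \<open>cnj h\<close>; the cross terms average to 0.\<close>
  let ?F = "\<lambda>s. f (?z s) * cnj (fst \<eta> * cis s + snd \<eta> * cis (- s))"
  have c: "continuous_on UNIV (\<lambda>s. k (?z s))" if "k holomorphic_on ball 0 1" for k :: "complex \<Rightarrow> complex"
    using that r by (intro continuous_on_circle_param cont) simp_all
  have hb: "has_bochner_integral circ_measure (\<lambda>s. k (?z s) * cis (- s)) (r * deriv k 0)"
    "has_bochner_integral circ_measure (\<lambda>s. k (?z s) * cis s) 0"
    if k: "k holomorphic_on ball 0 1" for k :: "complex \<Rightarrow> complex"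
  proof -
    have "continuous_on UNIV (\<lambda>s. k (?z s) * cis (- s))" "continuous_on UNIV (\<lambda>s. k (?z s) * cis s)"
      by (rule continuous_on_mult[OF c[OF k]], intro continuous_intros)+
    then show "has_bochner_integral circ_measure (\<lambda>s. k (?z s) * cis (- s)) (r * deriv k 0)"
      "has_bochner_integral circ_measure (\<lambda>s. k (?z s) * cis s) 0"
      using circ_integral_Cauchy[OF r(1) cont[OF k] holo[OF k], of 1]
        circ_integral_mult_cis[OF r(1) cont[OF k] holo[OF k]]
      by (simp_all add: has_bochner_integral_iff integrable_circ_continuous)
  qed
  have in_disc: "?z s \<in> ball 0 1" for s
    using r by (simp add: norm_mult)
  have F: "?F s = cnj (fst \<eta>) * (g (?z s) * cis (- s)) + cnj (snd \<eta>) * (g (?z s) * cis s)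
      + cnj (fst \<eta> * (h (?z s) * cis s) + snd \<eta> * (h (?z s) * cis (- s)))" for s
    unfolding f[OF in_disc] by (simp add: cis_cnj algebra_simps)
  have "has_bochner_integral circ_measure ?F (cnj (fst \<eta>) * (r * deriv g 0) + cnj (snd \<eta>) * 0
      + cnj (fst \<eta> * 0 + snd \<eta> * (r * deriv h 0)))"
    unfolding F
    by (intro has_bochner_integral_add has_bochner_integral_mult_right has_bochner_integral_cnj
        hb[OF g] hb[OF h])
  note F_int = this[unfolded has_bochner_integral_iff]
  have "integral\<^sup>L circ_measure ?F = cnj (fst \<eta>) * (r * deriv g 0) + cnj (snd \<eta> * (r * deriv h 0))"
    using F_int by simp
  also have "\<dots> = r * herm_pairing (wirtinger f 0, wirtinger_bar f 0) \<eta>"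
    unfolding w herm_pairing_def by (simp add: algebra_simps)
  finally have "r * norm (herm_pairing (wirtinger f 0, wirtinger_bar f 0) \<eta>) = norm (integral\<^sup>L circ_measure ?F)"
    using r by (simp add: norm_mult)
  also have "\<dots> \<le> (\<integral>s. norm (?F s) \<partial>circ_measure)"
    by (rule integral_norm_bound)
  also have "\<dots> \<le> (\<integral>s. norm (fst \<eta> + snd \<eta> * cis (- (2 * s))) \<partial>circ_measure)"
  proof (rule integral_mono)
    show "integrable circ_measure (\<lambda>s. norm (?F s))"
      using F_int by (intro integrable_norm) blast
    show "integrable circ_measure (\<lambda>s. norm (fst \<eta> + snd \<eta> * cis (- (2 * s))))"
      by (intro integrable_circ_continuous continuous_intros)
    fix s
    \<comment> \<open>Pulling out the unimodular \<open>cis s\<close> leaves the integrand of the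
      Hardy norm at the angle \<open>- (2 * s)\<close>, which
      \<open>circ_integral_cis_double\<close> turns back into \<open>t\<close>.\<close>
    have "fst \<eta> * cis s + snd \<eta> * cis (- s) = cis s * (fst \<eta> + snd \<eta> * cis (- (2 * s)))"
      by (simp add: algebra_simps cis_mult)
    then have "norm (cnj (fst \<eta> * cis s + snd \<eta> * cis (- s))) = norm (fst \<eta> + snd \<eta> * cis (- (2 * s)))"
      by (simp only: complex_mod_cnj norm_mult norm_cis mult_1)
    moreover have "norm (f (?z s)) \<le> 1"
      using disc in_disc[of s] by (force simp: image_subset_iff)
    ultimately show "norm (?F s) \<le> norm (fst \<eta> + snd \<eta> * cis (- (2 * s)))"
      unfolding norm_mult by (simp add: mult_left_le_one_le)
  qed
  also have "\<dots> = hardy_norm \<eta>"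
    unfolding hardy_norm_eq
    by (rule circ_integral_cis_double[where F = "\<lambda>w. norm (fst \<eta> + snd \<eta> * w)"])
      (intro continuous_intros)
  finally show ?thesis .
qed

lemma hardy_dual_norm_wirtinger_le:
  assumes "harmonic_on f (ball 0 1)" and "f ` ball 0 1 \<subseteq> ball 0 1"
  shows "hardy_dual_norm (wirtinger f 0, wirtinger_bar f 0) \<le> 1"
  unfolding hardy_dual_norm_def
proof (rule cSUP_least)
  have "hardy_norm 0 \<le> 1"
    by (simp add: hardy_norm_eq)
  then show "{\<eta>. hardy_norm \<eta> \<le> 1} \<noteq> {}"
    by blast
  fix \<eta> :: "complex \<times> complex"
  assume "\<eta> \<in> {\<eta>. hardy_norm \<eta> \<le> 1}"
  then have "r * norm (herm_pairing (wirtinger f 0, wirtinger_bar f 0) \<eta>) \<le> 1"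
    if "0 < r" "r < 1" for r
    using harmonic_on_norm_herm_pairing_le[OF assms that, of \<eta>] by simp
  then show "norm (herm_pairing (wirtinger f 0, wirtinger_bar f 0) \<eta>) \<le> 1"
    by (rule field_le_mult_one_interval)
qed

section \<open>The Hardy unit ball and the dual norm\<close>

lemma hardy_norm_ge:
  "norm (fst a) \<le> hardy_norm a" "norm (snd a) \<le> hardy_norm a"
proof -
  let ?f = "\<lambda>z. fst a + snd a * z"
  have f: "continuous_on (cball 0 1) ?f" "?f holomorphic_on ball 0 1"
    by (intro continuous_intros holomorphic_intros)+
  \<comment> \<open>The entries of \<open>a\<close> are the Fourier coefficients of order 0 and 1 of
    \<open>?f\<close>, and each coefficient is bounded by the mean of the modulus.\<close>
  have le: "norm (\<integral>t. ?f (cis t) * cis (- (real k * t)) \<partial>circ_measure) \<le> hardy_norm a" for k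
  proof -
    have "norm (\<integral>t. ?f (cis t) * cis (- (real k * t)) \<partial>circ_measure)
        \<le> (\<integral>t. norm (?f (cis t) * cis (- (real k * t))) \<partial>circ_measure)"
      by (rule integral_norm_bound)
    then show ?thesis
      by (simp add: hardy_norm_eq norm_mult)
  qed
  have "deriv ?f 0 = snd a"
    by (rule DERIV_imp_deriv) (auto intro!: derivative_eq_intros)
  then show "norm (fst a) \<le> hardy_norm a" "norm (snd a) \<le> hardy_norm a"
    using circ_integral_Cauchy[OF zero_less_one f, of 0] le[of 0]
      circ_integral_Cauchy[OF zero_less_one f, of 1] le[of 1] by simp_all
qed

lemma hardy_norm_scaleR: "hardy_norm (s *\<^sub>R a) = \<bar>s\<bar> * hardy_norm a"
proof -
  have "norm (fst (s *\<^sub>R a) + snd (s *\<^sub>R a) * cis t) = \<bar>s\<bar> * norm (fst a + snd a * cis t)" for t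
    using norm_scaleR[of s "fst a + snd a * cis t"] by (simp add: scaleR_right_distrib)
  then show ?thesis
    by (simp add: hardy_norm_eq)
qed

lemma continuous_on_hardy_norm: "continuous_on S hardy_norm"
proof -
  have "continuous_on (S \<times> cbox 0 (2 * pi))
      (\<lambda>(a, t). norm (fst a + snd a * exp (\<i> * complex_of_real t)))"
    unfolding split_def by (intro continuous_intros)
  from integral_continuous_on_param[OF this] show ?thesis
    unfolding hardy_norm_def by (intro continuous_intros) simp
qed

lemma compact_hardy_unit_ball: "compact {\<eta>. hardy_norm \<eta> \<le> 1}"
proof -
  have "norm \<eta> \<le> 2" if "hardy_norm \<eta> \<le> 1" for \<eta>
    using norm_Pair_le[of "fst \<eta>" "snd \<eta>"] hardy_norm_ge[of \<eta>] that by simp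
  then have "bounded {\<eta>. hardy_norm \<eta> \<le> 1}"
    by (auto simp: bounded_iff)
  moreover have "closed {\<eta>. hardy_norm \<eta> \<le> 1}"
    by (intro closed_Collect_le continuous_on_hardy_norm continuous_on_const)
  ultimately show ?thesis
    by (simp add: compact_eq_bounded_closed)
qed

lemma norm_herm_pairing_le_hardy_dual_norm:
  assumes "hardy_norm \<eta> \<le> 1"
  shows "norm (herm_pairing \<xi> \<eta>) \<le> hardy_dual_norm \<xi>"
  unfolding hardy_dual_norm_def
proof (rule cSUP_upper)
  have "continuous_on {\<eta>. hardy_norm \<eta> \<le> 1} (\<lambda>\<eta>. norm (herm_pairing \<xi> \<eta>))"
    unfolding herm_pairing_def by (intro continuous_intros)
  then show "bdd_above ((\<lambda>\<eta>. norm (herm_pairing \<xi> \<eta>)) ` {\<eta>. hardy_norm \<eta> \<le> 1})"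
    by (intro bounded_imp_bdd_above compact_imp_bounded compact_continuous_image compact_hardy_unit_ball)
qed (use assms in simp)

lemma herm_pairing_add_right: "herm_pairing \<xi> (\<eta> + \<zeta>) = herm_pairing \<xi> \<eta> + herm_pairing \<xi> \<zeta>"
  by (simp add: herm_pairing_def algebra_simps)

lemma herm_pairing_scaleR_right: "herm_pairing \<xi> (s *\<^sub>R \<eta>) = s *\<^sub>R herm_pairing \<xi> \<eta>"
  by (simp add: herm_pairing_def scaleR_conv_of_real algebra_simps)

text \<open>Testing a linear inequality against its own coefficient vector through this identity
  forces that vector to vanish.\<close>

lemma herm_pairing_self: "herm_pairing \<xi> \<xi> = of_real ((norm \<xi>)\<^sup>2)"
  by (simp add: herm_pairing_def norm_prod_def complex_norm_square del: of_real_power)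

section \<open>Differentiation of the Hardy norm and the extremal function\<close>

lemma AE_circ_nonzero:
  assumes "\<eta> \<noteq> 0"
  shows "AE t in circ_measure. fst \<eta> + snd \<eta> * cis t \<noteq> 0"
proof -
  have "countable {t. fst \<eta> + snd \<eta> * cis t = 0}"
  proof (cases "\<exists>s. fst \<eta> + snd \<eta> * cis s = 0")
    case True
    then obtain s where s: "fst \<eta> + snd \<eta> * cis s = 0" by blast
    have snd: "snd \<eta> \<noteq> 0"
    proof
      assume "snd \<eta> = 0"
      with s have "\<eta> = 0" by (simp add: prod_eq_iff)
      with assms show False by simp
    qed
    \<comment> \<open>As \<open>snd \<eta> \<noteq> 0\<close>, the equation determines
      \<open>cis t\<close>, so all zeros differ from \<open>s\<close> by multiples of
      \<open>2 * pi\<close>.\<close>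
    have "t \<in> range (\<lambda>n::int. s + 2 * pi * n)" if t: "fst \<eta> + snd \<eta> * cis t = 0" for t
    proof -
      have "snd \<eta> * cis t = snd \<eta> * cis s"
        using s t by (metis add_left_cancel)
      then have "cis t = cis s"
        using snd by simp
      then have "sin t = sin s \<and> cos t = cos s"
        by (simp add: complex_eq_iff)
      then show ?thesis
        unfolding sin_cos_eq_iff by auto
    qed
    then have "{t. fst \<eta> + snd \<eta> * cis t = 0} \<subseteq> range (\<lambda>n::int. s + 2 * pi * n)"
      by blast
    then show ?thesis
      by (rule countable_subset) simp
  qed simp
  then have "AE t in lborel. t \<notin> {t. fst \<eta> + snd \<eta> * cis t = 0}"
    by (intro AE_not_in countable_imp_null_set_lborel)
  then show ?thesis
    unfolding circ_measure_def by (intro AE_uniform_measureI) (auto elim: eventually_mono)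
qed

text \<open>Away from 0 the norm is differentiable, with derivative the inner product with
  \<open>sgn u\<close>. The step sizes form a sequence so that dominated convergence can be applied
  to the quotients.\<close>

lemma norm_quotient_tendsto:
  fixes u v :: "'a::real_inner"
  assumes "u \<noteq> 0"
  shows "(\<lambda>n. (norm (u + inverse (real (Suc n)) *\<^sub>R v) - norm u) / inverse (real (Suc n)))
    \<longlonglongrightarrow> inner (sgn u) v"
proof -
  have norm: "(norm has_derivative inner (sgn u)) (at (u + 0 *\<^sub>R v))"
    using has_derivative_norm[OF assms] by (simp add: inner_commute[of _ "sgn u"])
  have "((\<lambda>s. u + s *\<^sub>R v) has_derivative (\<lambda>s. s *\<^sub>R v)) (at 0)"
    by (auto intro!: derivative_eq_intros)
  from has_derivative_compose[OF this norm]
  have "((\<lambda>s. norm (u + s *\<^sub>R v)) has_derivative (\<lambda>s. inner (sgn u) (s *\<^sub>R v))) (at 0)" .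
  then have "((\<lambda>s. norm (u + s *\<^sub>R v)) has_field_derivative inner (sgn u) v) (at 0)"
    by (rule has_derivative_imp_has_field_derivative) simp
  then have "((\<lambda>s. (norm (u + s *\<^sub>R v) - norm u) / s) \<longlongrightarrow> inner (sgn u) v) (at 0)"
    by (simp add: DERIV_def)
  moreover have "filterlim (\<lambda>n. inverse (real (Suc n))) (at 0) sequentially"
    by (intro filterlim_atI LIMSEQ_inverse_real_of_nat) simp
  ultimately show ?thesis
    by (rule filterlim_compose)
qed

text \<open>Dominated convergence: by the reverse triangle inequality the quotients are at most
  \<open>norm (?v t)\<close>, and they converge wherever \<open>?u t \<noteq> 0\<close>, hence
  almost everywhere because \<open>\<eta> \<noteq> 0\<close>.\<close>

lemma hardy_norm_quotient_tendsto:
  assumes "\<eta> \<noteq> 0"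
  shows "(\<lambda>n. (hardy_norm (\<eta> + inverse (real (Suc n)) *\<^sub>R \<zeta>) - hardy_norm \<eta>) / inverse (real (Suc n)))
    \<longlonglongrightarrow> (\<integral>t. inner (sgn (fst \<eta> + snd \<eta> * cis t)) (fst \<zeta> + snd \<zeta> * cis t) \<partial>circ_measure)"
proof -
  let ?u = "\<lambda>t. fst \<eta> + snd \<eta> * cis t" and ?v = "\<lambda>t. fst \<zeta> + snd \<zeta> * cis t"
  define h where "h = (\<lambda>n. inverse (real (Suc n)))"
  have h: "0 < h n" for n
    by (simp add: h_def)
  let ?s = "\<lambda>n t. (norm (?u t + h n *\<^sub>R ?v t) - norm (?u t)) / h n"
  have cont: "continuous_on UNIV ?v" "continuous_on UNIV ?u" "continuous_on UNIV (\<lambda>t. norm (?u t + h n *\<^sub>R ?v t))" for n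
    by (intro continuous_intros)+
  have "(\<lambda>n. integral\<^sup>L circ_measure (?s n)) \<longlonglongrightarrow> (\<integral>t. inner (sgn (?u t)) (?v t) \<partial>circ_measure)"
  proof (rule integral_dominated_convergence[where w = "\<lambda>t. norm (?v t)"])
    show "integrable circ_measure (\<lambda>t. norm (?v t))"
      by (intro integrable_circ_continuous continuous_intros)
    show "AE t in circ_measure. (\<lambda>n. ?s n t) \<longlonglongrightarrow> inner (sgn (?u t)) (?v t)"
      using AE_circ_nonzero[OF assms] unfolding h_def
      by (rule eventually_mono) (rule norm_quotient_tendsto)
    show "AE t in circ_measure. norm (?s n t) \<le> norm (?v t)" for n
    proof (rule AE_I2)
      fix t
      have "\<bar>norm (?u t + h n *\<^sub>R ?v t) - norm (?u t)\<bar> \<le> norm (h n *\<^sub>R ?v t)"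
        using norm_triangle_ineq3[of "?u t + h n *\<^sub>R ?v t" "?u t"] by simp
      then show "norm (?s n t) \<le> norm (?v t)"
        using h[of n] by (simp add: divide_le_eq mult.commute)
    qed
    show "(\<lambda>t. inner (sgn (?u t)) (?v t)) \<in> borel_measurable circ_measure"
      unfolding sgn_div_norm
      using borel_measurable_continuous_onI[OF cont(1)] borel_measurable_continuous_onI[OF cont(2)]
      by measurable
    show "?s n \<in> borel_measurable circ_measure" for n
      using borel_measurable_continuous_onI[OF cont(1)] borel_measurable_continuous_onI[OF cont(2)]
      by measurable
  qed
  moreover have "integral\<^sup>L circ_measure (?s n) = (hardy_norm (\<eta> + h n *\<^sub>R \<zeta>) - hardy_norm \<eta>) / h n" for n
  proof -
    have "hardy_norm (\<eta> + h n *\<^sub>R \<zeta>) = (\<integral>t. norm (?u t + h n *\<^sub>R ?v t) \<partial>circ_measure)"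
      by (simp add: hardy_norm_eq algebra_simps)
    moreover have "integrable circ_measure (\<lambda>t. norm (?u t + h n *\<^sub>R ?v t))"
      by (rule integrable_circ_continuous[OF cont(3)])
    moreover have "integrable circ_measure (\<lambda>t. norm (?u t))"
      by (intro integrable_circ_continuous continuous_intros)
    ultimately show ?thesis
      by (simp add: hardy_norm_eq[of \<eta>])
  qed
  ultimately show ?thesis
    by (simp only: h_def)
qed

lemma hardy_dual_norm_extremal:
  assumes "hardy_dual_norm (\<alpha>, \<beta>) \<le> 1"
  obtains \<sigma> :: "real \<Rightarrow> complex" and N :: real
  where "\<sigma> \<in> borel_measurable borel" "\<And>t. norm (\<sigma> t) \<le> 1" "0 \<le> N" "N \<le> 1"
    "\<alpha> = of_real N * (\<integral>t. \<sigma> t \<partial>circ_measure)"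
    "\<beta> = of_real N * (\<integral>t. \<sigma> t * cis (- t) \<partial>circ_measure)"
proof -
  define \<xi> where "\<xi> = (\<alpha>, \<beta>)"
  define R where "R = (\<lambda>\<eta>. Re (herm_pairing \<xi> \<eta>))"
  have zero: "hardy_norm 0 \<le> 1"
    by (simp add: hardy_norm_eq)
  have "continuous_on {\<eta>. hardy_norm \<eta> \<le> 1} R"
    unfolding R_def herm_pairing_def by (intro continuous_intros)
  then have "\<exists>\<eta>\<in>{\<eta>. hardy_norm \<eta> \<le> 1}. \<forall>\<zeta>\<in>{\<eta>. hardy_norm \<eta> \<le> 1}. R \<zeta> \<le> R \<eta>"
    using zero by (intro continuous_attains_sup compact_hardy_unit_ball) blast
  then obtain \<eta> where \<eta>: "hardy_norm \<eta> \<le> 1" and max: "\<And>\<zeta>. hardy_norm \<zeta> \<le> 1 \<Longrightarrow> R \<zeta> \<le> R \<eta>"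
    by blast
  \<comment> \<open>Multiplying vectors by unimodular constants preserves the Hardy norm, so this
    maximum of real parts is the dual norm of \<open>\<xi>\<close>.\<close>
  define N where "N = R \<eta>"
  have "R 0 = 0"
    by (simp add: R_def herm_pairing_def)
  then have N0: "0 \<le> N"
    using max[OF zero] by (simp add: N_def)
  have "R \<eta> \<le> norm (herm_pairing \<xi> \<eta>)"
    unfolding R_def by (rule complex_Re_le_cmod)
  then have N1: "N \<le> 1"
    using norm_herm_pairing_le_hardy_dual_norm[OF \<eta>, of \<xi>] assms by (simp add: N_def \<xi>_def)
  have nonneg: "0 \<le> hardy_norm \<zeta>" for \<zeta>
    using hardy_norm_ge(1)[of \<zeta>] norm_ge_zero[of "fst \<zeta>"] by linarith
  \<comment> \<open>Homogeneity extends the bound from the unit ball to all vectors.\<close>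
  have R_le: "R \<zeta> \<le> N * hardy_norm \<zeta>" for \<zeta>
  proof (cases "hardy_norm \<zeta> = 0")
    case True
    then have "\<zeta> = 0"
      using hardy_norm_ge[of \<zeta>] by (simp add: prod_eq_iff)
    then show ?thesis
      using \<open>R 0 = 0\<close> True by simp
  next
    case False
    then have pos: "0 < hardy_norm \<zeta>"
      using nonneg[of \<zeta>] by simp
    have "R (inverse (hardy_norm \<zeta>) *\<^sub>R \<zeta>) \<le> N"
      unfolding N_def using pos by (intro max) (simp add: hardy_norm_scaleR)
    then show ?thesis
      using pos by (simp add: R_def herm_pairing_scaleR_right field_simps)
  qed
  show thesis
  proof (cases "N = 0")
    \<comment> \<open>Here the maximizer may be 0 and offers no sign function; but
      \<open>\<xi>\<close> itself vanishes, and the zero function serves as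
      \<open>\<sigma>\<close>.\<close>
    case True
    then have "(norm \<xi>)\<^sup>2 \<le> 0"
      using R_le[of \<xi>] by (simp add: R_def herm_pairing_self)
    then have "\<alpha> = 0" "\<beta> = 0"
      by (simp_all add: \<xi>_def prod_eq_iff)
    then show thesis
      using that[of "\<lambda>_. 0" 0] by simp
  next
    case False
    then have "\<eta> \<noteq> 0"
      using \<open>R 0 = 0\<close> by (auto simp: N_def)
    have "N \<le> N * hardy_norm \<eta>" "N * hardy_norm \<eta> \<le> N"
      using R_le[of \<eta>] mult_left_le[OF \<eta> N0] by (simp_all add: N_def)
    \<comment> \<open>So \<open>N * hardy_norm \<zeta> - R \<zeta>\<close>, nonnegative by
      \<open>R_le\<close>, takes its minimum 0 at \<open>\<eta>\<close>.\<close>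
    then have attained: "R \<eta> = N * hardy_norm \<eta>"
      by (simp add: N_def)
    \<comment> \<open>The modulus is 1 except on the null set of zeros, where \<open>sgn\<close>
      takes the value 0.\<close>
    define \<sigma> where "\<sigma> = (\<lambda>t. sgn (fst \<eta> + snd \<eta> * cis t))"
    have \<sigma>_meas: "\<sigma> \<in> borel_measurable borel"
    proof -
      have "(\<lambda>t. fst \<eta> + snd \<eta> * cis t) \<in> borel_measurable borel"
        by (intro borel_measurable_continuous_onI continuous_intros)
      then show ?thesis
        unfolding \<sigma>_def sgn_div_norm by measurable
    qed
    have \<sigma>_bound: "norm (\<sigma> t) \<le> 1" for t
      by (simp add: \<sigma>_def norm_sgn)
    define A where "A = (\<integral>t. \<sigma> t \<partial>circ_measure)"
    define B where "B = (\<integral>t. \<sigma> t * cis (- t) \<partial>circ_measure)"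
    have A: "has_bochner_integral circ_measure \<sigma> A"
      unfolding A_def
      by (intro has_bochner_integral_integrable integrable_circ_bounded[OF \<sigma>_meas \<sigma>_bound])
    have B: "has_bochner_integral circ_measure (\<lambda>t. \<sigma> t * cis (- t)) B"
      unfolding B_def
    proof (intro has_bochner_integral_integrable integrable_circ_bounded)
      show "(\<lambda>t. \<sigma> t * cis (- t)) \<in> borel_measurable borel"
        by (intro borel_measurable_times \<sigma>_meas borel_measurable_continuous_onI continuous_intros)
      show "norm (\<sigma> t * cis (- t)) \<le> 1" for t
        using \<sigma>_bound[of t] by (simp add: norm_mult)
    qed
    have deriv: "(\<integral>t. inner (\<sigma> t) (fst \<zeta> + snd \<zeta> * cis t) \<partial>circ_measure) = Re (herm_pairing (A, B) \<zeta>)" for \<zeta>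
    proof -
      have "has_bochner_integral circ_measure
          (\<lambda>t. Re (\<sigma> t * cnj (fst \<zeta>) + \<sigma> t * cis (- t) * cnj (snd \<zeta>))) (Re (A * cnj (fst \<zeta>) + B * cnj (snd \<zeta>)))"
        by (intro has_bochner_integral_Re has_bochner_integral_add has_bochner_integral_mult_left A B)
      moreover have "Re (\<sigma> t * cnj (fst \<zeta>) + \<sigma> t * cis (- t) * cnj (snd \<zeta>)) =
          inner (\<sigma> t) (fst \<zeta> + snd \<zeta> * cis t)" for t
        by (simp add: inner_complex_def algebra_simps)
      ultimately show ?thesis
        by (simp add: has_bochner_integral_iff herm_pairing_def)
    qed
    \<comment> \<open>The right-hand side is \<open>N\<close> times the one-sided derivative of the
      Hardy norm at \<open>\<eta>\<close> along \<open>\<zeta>\<close>. Each difference quotient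
      already satisfies the bound, because \<open>R\<close> is real-linear and lies below
      \<open>N * hardy_norm\<close> with equality at \<open>\<eta>\<close>.\<close>
    have le: "R \<zeta> \<le> N * Re (herm_pairing (A, B) \<zeta>)" for \<zeta>
    proof -
      have lim: "(\<lambda>n. N * ((hardy_norm (\<eta> + inverse (real (Suc n)) *\<^sub>R \<zeta>) - hardy_norm \<eta>) / inverse (real (Suc n))))
          \<longlonglongrightarrow> N * Re (herm_pairing (A, B) \<zeta>)"
        using hardy_norm_quotient_tendsto[OF \<open>\<eta> \<noteq> 0\<close>, of \<zeta>]
        unfolding deriv[of \<zeta>, unfolded \<sigma>_def] by (rule tendsto_mult_left)
      have ge: "R \<zeta> \<le> N * ((hardy_norm (\<eta> + inverse (real (Suc n)) *\<^sub>R \<zeta>) - hardy_norm \<eta>) / inverse (real (Suc n)))" for n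
      proof -
        define s where "s = inverse (real (Suc n))"
        have s: "0 < s" by (simp add: s_def)
        have "R (\<eta> + s *\<^sub>R \<zeta>) = R \<eta> + s * R \<zeta>"
          by (simp add: R_def herm_pairing_add_right herm_pairing_scaleR_right)
        then have "s * R \<zeta> \<le> N * (hardy_norm (\<eta> + s *\<^sub>R \<zeta>) - hardy_norm \<eta>)"
          using R_le[of "\<eta> + s *\<^sub>R \<zeta>"] attained by (simp add: algebra_simps)
        then show ?thesis
          unfolding s_def[symmetric] using s by (simp add: field_simps)
      qed
      show ?thesis
        by (rule LIMSEQ_le_const[OF lim]) (intro exI allI impI ge)
    qed
    \<comment> \<open>By \<open>le\<close>, the pairing of \<open>\<delta>\<close> with every
      \<open>\<zeta>\<close> has real part at most 0; the choice of \<open>\<delta>\<close> for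
      \<open>\<zeta>\<close> gives \<open>\<delta> = 0\<close>.\<close>
    define \<delta> where "\<delta> = \<xi> - N *\<^sub>R (A, B)"
    have "R \<zeta> - N * Re (herm_pairing (A, B) \<zeta>) = Re (herm_pairing \<delta> \<zeta>)" for \<zeta>
      by (simp add: R_def \<delta>_def herm_pairing_def algebra_simps)
    then have "Re (herm_pairing \<delta> \<delta>) \<le> 0"
      using le[of \<delta>] by (metis diff_le_0_iff_le)
    then have "\<delta> = 0"
      by (simp add: herm_pairing_self)
    then have "\<alpha> = of_real N * A" "\<beta> = of_real N * B"
      by (simp_all add: \<delta>_def \<xi>_def prod_eq_iff scaleR_conv_of_real)
    then show thesis
      using that[OF \<sigma>_meas \<sigma>_bound N0 N1] unfolding A_def B_def by blast
  qed
qed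

section \<open>Odd Poisson integrals and the construction of the harmonic map\<close>

lemma holomorphic_on_circ_Cauchy_transform:
  fixes \<psi> :: "real \<Rightarrow> complex"
  assumes meas: "\<psi> \<in> borel_measurable borel" and bound: "\<And>t. norm (\<psi> t) \<le> 1"
  shows "(\<lambda>u. \<integral>t. \<psi> t / (1 - u * cis t) \<partial>circ_measure) holomorphic_on ball 0 1"
proof (rule power_series_holomorphic)
  fix w :: complex
  assume "w \<in> ball 0 1"
  then have w: "norm w < 1" by simp
  \<comment> \<open>Expanding \<open>1 / (1 - w * cis t)\<close> as a geometric series, dominated by
    \<open>norm w ^ n\<close>, gives a power series whose coefficients are the moments of
    \<open>\<psi>\<close>.\<close>
  let ?f = "\<lambda>n t. \<psi> t * (w * cis t) ^ n"
  have le: "norm (?f n t) \<le> norm w ^ n" for n t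
    using mult_right_mono[OF bound[of t], of "norm w ^ n"] by (simp add: norm_mult norm_power)
  have int: "integrable circ_measure (?f n)" for n
    by (rule integrable_circ_bounded[OF _ le])
      (intro borel_measurable_times meas borel_measurable_continuous_onI continuous_intros)
  have geom: "summable (\<lambda>n. norm w ^ n)"
    using w by (intro summable_geometric) simp
  have "(\<lambda>n. integral\<^sup>L circ_measure (?f n)) sums (\<integral>t. (\<Sum>n. ?f n t) \<partial>circ_measure)"
  proof (rule sums_integral[OF int])
    show "AE t in circ_measure. summable (\<lambda>n. norm (?f n t))"
      by (intro AE_I2 summable_comparison_test'[OF geom, of 0]) (use le in simp)
    show "summable (\<lambda>n. \<integral>t. norm (?f n t) \<partial>circ_measure)"
    proof (rule summable_comparison_test'[OF geom, of 0])
      fix n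
      have "(\<integral>t. norm (?f n t) \<partial>circ_measure) \<le> (\<integral>t. norm w ^ n \<partial>circ_measure)"
        by (intro integral_mono integrable_norm int le) simp
      then show "norm (\<integral>t. norm (?f n t) \<partial>circ_measure) \<le> norm w ^ n"
        using circ.prob_space by simp
    qed
  qed
  moreover have "(\<Sum>n. ?f n t) = \<psi> t / (1 - w * cis t)" for t
    using w suminf_mult[OF summable_geometric, of "w * cis t" "\<psi> t"]
    by (simp add: suminf_geometric norm_mult)
  moreover have "integral\<^sup>L circ_measure (?f n) = (\<integral>t. \<psi> t * cis t ^ n \<partial>circ_measure) * (w - 0) ^ n" for n
  proof -
    have "?f n = (\<lambda>t. \<psi> t * cis t ^ n * w ^ n)"
      by (simp add: power_mult_distrib mult_ac)
    then show ?thesis by simp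
  qed
  ultimately show "(\<lambda>n. (\<integral>t. \<psi> t * cis t ^ n \<partial>circ_measure) * (w - 0) ^ n) sums
      (\<integral>t. \<psi> t / (1 - w * cis t) \<partial>circ_measure)"
    by simp
qed

text \<open>The real part is the Poisson kernel
  \<open>(1 - (norm w)\<^sup>2) / (norm (1 - w))\<^sup>2\<close>, and
  \<open>norm (1 - w) \<le> 1 + norm w\<close>; this is Harnack's lower bound.\<close>

lemma Re_disc_halfplane_ge:
  assumes w: "norm w < 1"
  shows "(1 - norm w) / (1 + norm w) \<le> Re ((1 + w) / (1 - w))"
proof -
  have ne: "1 - w \<noteq> 0"
    using w by auto
  have le: "norm (1 - w) \<le> 1 + norm w"
    using norm_triangle_ineq4[of 1 w] by simp
  have "1 + norm w \<noteq> 0"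
    using norm_ge_zero[of w] by linarith
  then have "(1 - norm w) / (1 + norm w) = (1 - norm w) * (1 + norm w) / ((1 + norm w) * (1 + norm w))"
    by simp
  also have "\<dots> = (1 - (norm w)\<^sup>2) / (1 + norm w)\<^sup>2"
    by (simp add: power2_eq_square algebra_simps)
  also have "\<dots> \<le> (1 - (norm w)\<^sup>2) / (norm (1 - w))\<^sup>2"
    using w ne le by (intro divide_left_mono power_mono mult_pos_pos) (auto simp: power_le_one)
  also have "\<dots> = Re ((1 + w) / (1 - w))"
    unfolding Re_divide cmod_power2 by (simp add: power2_eq_square algebra_simps)
  finally show ?thesis .
qed

text \<open>The left-hand side is the part of the Poisson kernel that is odd in \<open>w\<close>, the first term on the
  right its even part.\<close>

lemma abs_odd_Poisson_le:
  assumes w: "norm w < 1"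
  shows "\<bar>2 * Re (w / (1 - w\<^sup>2))\<bar> \<le> Re ((1 + w\<^sup>2) / (1 - w\<^sup>2)) - (1 - norm w) / (1 + norm w)"
proof -
  have ne: "1 - w \<noteq> 0" "1 + w \<noteq> 0"
    using w norm_minus_cancel[of w] by (auto simp: add_eq_0_iff)
  have sq: "1 - w\<^sup>2 = (1 - w) * (1 + w)"
    by (simp add: power2_eq_square algebra_simps)
  define e where "e = (1 + w\<^sup>2) / (1 - w\<^sup>2)"
  define v where "v = w / (1 - w\<^sup>2)"
  \<comment> \<open>In real parts, even part plus and minus odd part are the Poisson kernel at
    \<open>w\<close> and at \<open>- w\<close>; Harnack's bound applies to both.\<close>
  have "(1 + w) / (1 - w) = e + 2 * v" "(1 - w) / (1 + w) = e - 2 * v"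
    unfolding e_def v_def sq using ne
    by (simp_all add: divide_simps power2_eq_square) (simp_all add: algebra_simps)
  then have "(1 - norm w) / (1 + norm w) \<le> Re e + 2 * Re v"
    "(1 - norm w) / (1 + norm w) \<le> Re e - 2 * Re v"
    using Re_disc_halfplane_ge[of w] Re_disc_halfplane_ge[of "- w"] w by simp_all
  then show ?thesis
    unfolding e_def[symmetric] v_def[symmetric] by linarith
qed

text \<open>Under one integral, the two terms pair the boundary values
  \<open>\<sigma> t * cis (- (t / 2))\<close> with the odd Poisson kernel. The integrand has modulus
  at most the even kernel minus \<open>c\<close>, and the even kernel has mean 1, so the whole has
  modulus at most \<open>1 - c\<close>.\<close>

lemma norm_odd_Poisson_integral_less_1:
  assumes meas: "\<sigma> \<in> borel_measurable borel" and bound: "\<And>t. norm (\<sigma> t) \<le> 1"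
    and z: "norm z < 1"
  shows "norm (z * (\<integral>t. \<sigma> t / (1 - z\<^sup>2 * cis t) \<partial>circ_measure)
    + cnj (z * (\<integral>t. cnj (\<sigma> t) * cis t / (1 - z\<^sup>2 * cis t) \<partial>circ_measure))) < 1"
proof -
  have z2: "norm (z\<^sup>2) < 1"
    using z by (simp add: norm_power power_less_one_iff abs_square_less_1)
  have den: "1 - norm (z\<^sup>2) \<le> norm (1 - z\<^sup>2 * cis t)" for t
    using norm_triangle_ineq2[of 1 "z\<^sup>2 * cis t"] by (simp add: norm_mult)
  have ne: "1 - z\<^sup>2 * cis t \<noteq> 0" for t
    using den[of t] z2 by auto
  have bnd: "integrable circ_measure (\<lambda>t. \<psi> t / (1 - z\<^sup>2 * cis t))"
    if "\<psi> \<in> borel_measurable borel" "\<And>t. norm (\<psi> t) \<le> 1" for \<psi>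
  proof (rule integrable_circ_bounded)
    show "(\<lambda>t. \<psi> t / (1 - z\<^sup>2 * cis t)) \<in> borel_measurable borel"
      by (intro borel_measurable_divide that borel_measurable_continuous_onI continuous_intros)
    show "norm (\<psi> t / (1 - z\<^sup>2 * cis t)) \<le> 1 / (1 - norm (z\<^sup>2))" for t
      unfolding norm_divide using that(2)[of t] den[of t] z2 by (intro frac_le) auto
  qed
  have cmeas: "(\<lambda>t. cnj (\<sigma> t) * cis t) \<in> borel_measurable borel"
    by (intro borel_measurable_times borel_measurable_continuous_on[OF _ meas] borel_measurable_continuous_onI
        continuous_intros)
  note int = bnd[OF meas bound] bnd[OF cmeas]
  let ?q = "\<lambda>t. z * (\<sigma> t / (1 - z\<^sup>2 * cis t)) + cnj (z * (cnj (\<sigma> t) * cis t / (1 - z\<^sup>2 * cis t)))"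
  let ?p = "\<lambda>t. (1 + z\<^sup>2 * cis t) / (1 - z\<^sup>2 * cis t)"
  define c where "c = (1 - norm z) / (1 + norm z)"
  have c: "0 < c"
    using z norm_ge_zero[of z] unfolding c_def by (intro divide_pos_pos) linarith+
  have pt: "norm (?q t) \<le> Re (?p t) - c" for t
  proof -
    \<comment> \<open>This is \<open>z\<close> divided by the boundary point
      \<open>cis (- (t / 2))\<close>, the argument of the Poisson kernel for that point.\<close>
    define w where "w = z * cis (t / 2)"
    have half: "cis (t / 2) * cis (t / 2) = cis t" "cis (- (t / 2)) * cis (t / 2) = 1"
      by (simp_all add: cis_mult)
    have w2: "w\<^sup>2 = z\<^sup>2 * cis t"
      unfolding w_def by (simp add: power_mult_distrib power2_eq_square half)
    have nw: "norm w = norm z"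
      unfolding w_def by (simp add: norm_mult)
    have "z * (\<sigma> t / (1 - z\<^sup>2 * cis t)) = \<sigma> t * cis (- (t / 2)) * (w / (1 - w\<^sup>2))"
      unfolding w2 unfolding w_def using half(2) by (simp add: mult_ac)
    moreover have "z * (cnj (\<sigma> t) * cis t / (1 - z\<^sup>2 * cis t)) =
        cnj (\<sigma> t * cis (- (t / 2))) * (w / (1 - w\<^sup>2))"
      unfolding w2 unfolding w_def half(1)[symmetric] by (simp add: cis_cnj mult_ac)
    ultimately have "?q t = \<sigma> t * cis (- (t / 2)) * (w / (1 - w\<^sup>2) + cnj (w / (1 - w\<^sup>2)))"
      by (simp add: distrib_left)
    also have "\<dots> = \<sigma> t * cis (- (t / 2)) * of_real (2 * Re (w / (1 - w\<^sup>2)))"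
      by (simp only: complex_add_cnj)
    finally have "norm (?q t) = norm (\<sigma> t) * \<bar>2 * Re (w / (1 - w\<^sup>2))\<bar>"
      by (simp only: norm_mult norm_cis norm_of_real mult_1_right)
    also have "\<dots> \<le> \<bar>2 * Re (w / (1 - w\<^sup>2))\<bar>"
      using bound[of t] by (intro mult_left_le_one_le) simp_all
    also have "\<dots> \<le> Re (?p t) - c"
      using abs_odd_Poisson_le[of w] z unfolding nw w2 c_def by blast
    finally show ?thesis .
  qed
  have p_cont: "continuous_on UNIV ?p"
    using ne by (intro continuous_intros) auto
  have "(\<integral>t. ?p t \<partial>circ_measure) = 1"
  proof -
    have ne': "1 - z\<^sup>2 * u \<noteq> 0" if "norm u \<le> 1" for u
    proof
      assume "1 - z\<^sup>2 * u = 0"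
      then have "norm (z\<^sup>2) * norm u = 1"
        by (metis eq_iff_diff_eq_0 norm_mult norm_one)
      then show False
        using z2 that mult_left_le[OF that, of "norm (z\<^sup>2)"] by simp
    qed
    \<comment> \<open>In the variable \<open>u = cis t\<close> the integrand extends to
      \<open>?P\<close>, which is holomorphic in the disc, continuous up to the boundary and equal
      to 1 at 0.\<close>
    let ?P = "\<lambda>u. (1 + z\<^sup>2 * u) / (1 - z\<^sup>2 * u)"
    have "continuous_on (cball 0 1) ?P" "?P holomorphic_on ball 0 1"
      using ne' by (auto intro!: continuous_intros holomorphic_intros simp del: right_minus_eq)
    from circ_integral_mean_value[OF zero_less_one this] show ?thesis
      by simp
  qed
  then have mean: "(\<integral>t. Re (?p t) - c \<partial>circ_measure) = 1 - c"
    using integrable_circ_continuous[OF p_cont] circ.prob_space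
    by (simp add: integral_Re del: Re_divide)
  have "has_bochner_integral circ_measure ?q (z * (\<integral>t. \<sigma> t / (1 - z\<^sup>2 * cis t) \<partial>circ_measure)
    + cnj (z * (\<integral>t. cnj (\<sigma> t) * cis t / (1 - z\<^sup>2 * cis t) \<partial>circ_measure)))"
    using bound by (intro has_bochner_integral_add has_bochner_integral_mult_right
        has_bochner_integral_cnj has_bochner_integral_integrable int) (simp add: norm_mult)
  then have q: "integrable circ_measure ?q"
    and eq: "z * (\<integral>t. \<sigma> t / (1 - z\<^sup>2 * cis t) \<partial>circ_measure)
    + cnj (z * (\<integral>t. cnj (\<sigma> t) * cis t / (1 - z\<^sup>2 * cis t) \<partial>circ_measure)) = integral\<^sup>L circ_measure ?q"
    by (simp_all only: has_bochner_integral_iff)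
  have "norm (integral\<^sup>L circ_measure ?q) \<le> (\<integral>t. norm (?q t) \<partial>circ_measure)"
    by (rule integral_norm_bound)
  also have "\<dots> \<le> (\<integral>t. Re (?p t) - c \<partial>circ_measure)"
    by (rule integral_mono[OF integrable_norm[OF q] _ pt])
      (intro integrable_circ_continuous continuous_on_diff continuous_on_Re p_cont continuous_on_const)
  also have "\<dots> < 1"
    using mean c by simp
  finally show ?thesis
    unfolding eq .
qed

lemma exists_harmonic_self_map_disc:
  fixes \<sigma> :: "real \<Rightarrow> complex"
  assumes meas: "\<sigma> \<in> borel_measurable borel" and bound: "\<And>t. norm (\<sigma> t) \<le> 1"
    and N: "0 \<le> N" "N \<le> 1"
  obtains f where "harmonic_on f (ball 0 1)" "f ` ball 0 1 \<subseteq> ball 0 1"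
    "wirtinger f 0 = of_real N * (\<integral>t. \<sigma> t \<partial>circ_measure)"
    "wirtinger_bar f 0 = of_real N * (\<integral>t. \<sigma> t * cis (- t) \<partial>circ_measure)"
proof -
  define G where "G = (\<lambda>u. \<integral>t. \<sigma> t / (1 - u * cis t) \<partial>circ_measure)"
  define H where "H = (\<lambda>u. \<integral>t. cnj (\<sigma> t) * cis t / (1 - u * cis t) \<partial>circ_measure)"
  have G: "G holomorphic_on ball 0 1"
    unfolding G_def by (rule holomorphic_on_circ_Cauchy_transform[OF meas bound])
  have H: "H holomorphic_on ball 0 1"
    unfolding H_def
  proof (rule holomorphic_on_circ_Cauchy_transform)
    show "(\<lambda>t. cnj (\<sigma> t) * cis t) \<in> borel_measurable borel"
      by (intro borel_measurable_times borel_measurable_continuous_on[OF _ meas] borel_measurable_continuous_onI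
        continuous_intros)
  qed (use bound in \<open>simp add: norm_mult\<close>)
  \<comment> \<open>The function \<open>z * k (z\<^sup>2)\<close> is odd, as the Poisson integral of
    odd boundary values must be. Its derivative at 0 is \<open>k 0\<close>, for \<open>G\<close> and
    \<open>H\<close> a Fourier coefficient of \<open>\<sigma>\<close> or the conjugate of
    one.\<close>
  define lift where "lift = (\<lambda>k z. of_real N * (z * k (z\<^sup>2) :: complex))"
  have lift_holo: "lift k holomorphic_on ball 0 1"
    and lift_deriv: "deriv (lift k) 0 = of_real N * k 0"
    if k: "k holomorphic_on ball 0 1" for k
  proof -
    have k2: "(\<lambda>z. k (z\<^sup>2)) holomorphic_on ball 0 1"
      by (rule holomorphic_on_compose_gen[OF _ k, unfolded o_def])
        (auto intro!: holomorphic_intros simp: norm_power abs_square_less_1)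
    show "lift k holomorphic_on ball 0 1"
      unfolding lift_def by (intro holomorphic_intros k2)
    \<comment> \<open>In the product rule this derivative is multiplied by \<open>z = 0\<close>, so
      its existence is enough.\<close>
    have "((\<lambda>z. k (z\<^sup>2)) has_field_derivative deriv (\<lambda>z. k (z\<^sup>2)) 0) (at 0)"
      by (rule holomorphic_derivI[OF k2]) simp_all
    then have "(lift k has_field_derivative of_real N * k 0) (at 0)"
      unfolding lift_def by (auto intro!: derivative_eq_intros)
    then show "deriv (lift k) 0 = of_real N * k 0"
      by (rule DERIV_imp_deriv)
  qed
  define f where "f = (\<lambda>z. lift G z + cnj (lift H z))"
  show thesis
  proof
    show "harmonic_on f (ball 0 1)"
      unfolding f_def by (intro harmonic_on_holomorphic_add_cnj lift_holo G H open_ball)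
    show "f ` ball 0 1 \<subseteq> ball 0 1"
    proof clarify
      fix z :: complex
      assume "z \<in> ball 0 1"
      then have *: "norm (z * G (z\<^sup>2) + cnj (z * H (z\<^sup>2))) < 1"
        unfolding G_def H_def by (intro norm_odd_Poisson_integral_less_1 meas bound) simp
      have "f z = of_real N * (z * G (z\<^sup>2) + cnj (z * H (z\<^sup>2)))"
        unfolding f_def lift_def by (simp add: algebra_simps)
      then have "norm (f z) = N * norm (z * G (z\<^sup>2) + cnj (z * H (z\<^sup>2)))"
        using N by (simp only: norm_mult norm_of_real abs_of_nonneg)
      also have "\<dots> < 1"
        using mult_left_le_one_le[OF norm_ge_zero N] * by (rule order.strict_trans1)
      finally show "f z \<in> ball 0 1" by simp
    qed
    have w: "wirtinger f 0 = deriv (lift G) 0" "wirtinger_bar f 0 = cnj (deriv (lift H) 0)"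
      by (rule partials_holomorphic_add_cnj(3,4)[OF open_ball lift_holo[OF G] lift_holo[OF H]];
          simp add: f_def)+
    show "wirtinger f 0 = of_real N * (\<integral>t. \<sigma> t \<partial>circ_measure)"
      unfolding w lift_deriv[OF G] by (simp add: G_def)
    have "cnj (H 0) = (\<integral>t. cnj (cnj (\<sigma> t) * cis t) \<partial>circ_measure)"
      unfolding H_def by (simp del: complex_cnj_mult)
    then show "wirtinger_bar f 0 = of_real N * (\<integral>t. \<sigma> t * cis (- t) \<partial>circ_measure)"
      unfolding w lift_deriv[OF H] by (simp add: cis_cnj)
  qed
qed

theorem theorem1p1:
  fixes \<alpha> \<beta> :: complex
  shows "(\<exists>f :: complex \<Rightarrow> complex.
            harmonic_on f (ball 0 1) \<and> f ` ball 0 1 \<subseteq> ball 0 1 \<and>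
            (wirtinger f 0, wirtinger_bar f 0) = (\<alpha>, \<beta>))
         \<longleftrightarrow> hardy_dual_norm (\<alpha>, \<beta>) \<le> 1"
proof
  assume "\<exists>f :: complex \<Rightarrow> complex. harmonic_on f (ball 0 1) \<and> f ` ball 0 1 \<subseteq> ball 0 1 \<and>
      (wirtinger f 0, wirtinger_bar f 0) = (\<alpha>, \<beta>)"
  then show "hardy_dual_norm (\<alpha>, \<beta>) \<le> 1"
    using hardy_dual_norm_wirtinger_le by metis
next
  assume "hardy_dual_norm (\<alpha>, \<beta>) \<le> 1"
  then obtain \<sigma> :: "real \<Rightarrow> complex" and N :: real
    where \<sigma>: "\<sigma> \<in> borel_measurable borel" "\<And>t. norm (\<sigma> t) \<le> 1" and N: "0 \<le> N" "N \<le> 1"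
      and eq: "\<alpha> = of_real N * (\<integral>t. \<sigma> t \<partial>circ_measure)"
        "\<beta> = of_real N * (\<integral>t. \<sigma> t * cis (- t) \<partial>circ_measure)"
    by (rule hardy_dual_norm_extremal) (rule that)
  obtain f where "harmonic_on f (ball 0 1)" "f ` ball 0 1 \<subseteq> ball 0 1"
    "wirtinger f 0 = \<alpha>" "wirtinger_bar f 0 = \<beta>"
    unfolding eq by (rule exists_harmonic_self_map_disc[OF \<sigma> N])
  then show "\<exists>f :: complex \<Rightarrow> complex. harmonic_on f (ball 0 1) \<and> f ` ball 0 1 \<subseteq> ball 0 1 \<and>
      (wirtinger f 0, wirtinger_bar f 0) = (\<alpha>, \<beta>)"
    by blast
qed

end
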